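(* Let $\tau\sim(\tau^0,\dots,\tau^n)$ be a $\mathbb{G}$-stopping time. Then $\{\tau^0<\zeta_1\}=\{\tau<\zeta_1\}$; for $k=1,\dots,n-1$, $$\{\tau^0\geq\zeta_1\}\cap\dots\cap\{\tau^{k-1}\geq\zeta_k\}\cap\{\tau^k<\zeta_{k+1}\}=\{\zeta_k\leq\tau<\zeta_{k+1}\};$$ and $\{\tau^0\geq\zeta_1\}\cap\dots\cap\{\tau^{n-1}\geq\zeta_n\}=\{\zeta_n\leq\tau\}$. Therefore, $$\tau=\tau^0 1_{\{\tau<\zeta_1\}}+\sum_{k=1}^{n-1}\tau^k1_{\{\zeta_k\leq \tau <\zeta_{k+1}\}}+\tau^n 1_{\{\zeta_n\leq\tau\}}.$$
   Context: Probabilistic setting. On a probability space $(\Omega,\mathbb{P})$, $\mathbb{F}=(\mathcal{F}_t)_{t\ge 0}$ is the filtration generated by a Brownian motion, satisfying the usual conditions. There are at most $n\ge 1$ jumps: $0\le\zeta_1\le\dots\le\zeta_n$ are random (jump) times and $\ell_1,\dots,\ell_n$ are random marks valued in a Borel subset $E$ of $\mathbb{R}^{\hat d}$. Write $\pmb\zeta_k=(\zeta_1,\dots,\zeta_k)$, $\pmb\ell_k=(\ell_1,\dots,\ell_k)$. For $k=0,\dots,n$ let $$\mathcal{D}^{k}_t=\bigvee_{i=1}^{k}\big(\sigma(1_{\{\zeta_i\leq s\}},\ s\leq t)\vee\sigma(\ell_i1_{\{\zeta_i\leq s\}},\ s\leq t)\big),\qquad \mathcal{G}^k_t=\mathcal{F}_t\vee\mathcal{D}^k_t,$$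 $\mathbb{G}^k=(\mathcal{G}^k_t)_{t\ge0}$ (so $\mathbb{G}^0=\mathbb{F}$), and $\mathbb{G}=\mathbb{G}^n$. These filtrations are not assumed to be right-continuous. A $\mathbb{G}^k$-stopping time is a $[0,\infty]$-valued random time $\tau$ with $\{\tau\le t\}\in\mathcal{G}^k_t$ for all $t\ge 0$. Notation $\tau\sim(\tau^0,\dots,\tau^n)$: it means that $\tau^0$ is an $\mathbb{F}$-stopping time, $\tau^k=\tau^k(\pmb\zeta_k,\pmb\ell_k)$ is a $\mathbb{G}^k$-stopping time with $\tau^k\ge\zeta_k$ for $k=1,\dots,n$, and $$\tau=\tau^0 1_{\{\tau^0<\zeta_1\}}+\sum_{k=1}^{n-1}\tau^k 1_{\{\tau^0\geq\zeta_1\}\cap\dots\cap\{\tau^{k-1}\geq\zeta_k\}\cap\{\tau^k <\zeta_{k+1}\}}+\tau^n 1_{\{\tau^0\geq\zeta_1\}\cap\dots\cap\{\tau^{n-1}\geq\zeta_n\}}.$$ *)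

theory Defs
  imports "HOL-Probability.Probability"
begin

text \<open>
  Sigma-algebras on the sample space are represented by their sets of events; time is a real
  number \<open>t \<ge> 0\<close>, while random times take values in \<open>[0, \<infinity>]\<close>, i.e. in type \<^typ>\<open>ennreal\<close>.
  The jump times \<open>\<zeta>\<close>, marks \<open>L\<close> and component stopping times are indexed by natural numbers, of which only
  \<open>1..n\<close> (respectively \<open>0..n\<close>) are relevant.
\<close>

definition generated_sigma ::
  "'a set \<Rightarrow> ('a \<Rightarrow> 'b::topological_space) set \<Rightarrow> 'a set set" where
  "generated_sigma \<Omega> \<X> = sigma_sets \<Omega> {X -` B \<inter> \<Omega> | X B. X \<in> \<X> \<and> B \<in> sets borel}"

definition sigma_join :: "'a set \<Rightarrow> 'a set set \<Rightarrow> 'a set set \<Rightarrow> 'a set set" where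
  "sigma_join \<Omega> \<A> \<B> = sigma_sets \<Omega> (\<A> \<union> \<B>)"

definition usual_conditions :: "'a measure \<Rightarrow> (real \<Rightarrow> 'a set set) \<Rightarrow> bool" where
  "usual_conditions M \<F> \<longleftrightarrow>
     complete_measure M \<and>
     (\<forall>t\<ge>0. sigma_algebra (space M) (\<F> t) \<and> \<F> t \<subseteq> sets M) \<and>
     (\<forall>s t. 0 \<le> s \<and> s \<le> t \<longrightarrow> \<F> s \<subseteq> \<F> t) \<and>
     null_sets M \<subseteq> \<F> 0 \<and>
     (\<forall>t\<ge>0. \<F> t = (\<Inter>s\<in>{t<..}. \<F> s))"

definition brownian_motion :: "'a measure \<Rightarrow> (real \<Rightarrow> 'a \<Rightarrow> real ^ 'm) \<Rightarrow> bool" where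
  "brownian_motion M W \<longleftrightarrow>
     prob_space M \<and>
     (\<forall>t\<ge>0. W t \<in> borel_measurable M) \<and>
     (AE \<omega> in M. W 0 \<omega> = 0) \<and>
     (AE \<omega> in M. continuous_on {0..} (\<lambda>t. W t \<omega>)) \<and>
     (\<forall>(N::nat) (t::nat \<Rightarrow> real). 0 \<le> t 0 \<and> mono t \<longrightarrow>
        prob_space.indep_vars M (\<lambda>_. borel) (\<lambda>i \<omega>. W (t (Suc i)) \<omega> - W (t i) \<omega>) {..<N}) \<and>
     (\<forall>s t. 0 \<le> s \<and> s < t \<longrightarrow>
        distributed M lborel (\<lambda>\<omega>. W t \<omega> - W s \<omega>)
          (\<lambda>x. ennreal (\<Prod>j\<in>UNIV. normal_density 0 (sqrt (t - s)) (x $ j))))"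

text \<open>
  The filtration generated by \<open>W\<close> in the sense of the usual conditions: the natural filtration,
  augmented by the null sets and made right-continuous.
\<close>

definition brownian_filtration ::
  "'a measure \<Rightarrow> (real \<Rightarrow> 'a \<Rightarrow> real ^ 'm) \<Rightarrow> real \<Rightarrow> 'a set set" where
  "brownian_filtration M W t =
     (\<Inter>s\<in>{t<..}. sigma_join (space M) (generated_sigma (space M) (W ` {0..s})) (null_sets M))"

text \<open>
  \<open>jump_info M \<zeta> L k t\<close> is \<open>\<D>\<close> with upper index \<open>k\<close> at time \<open>t\<close>; for \<open>k = 0\<close> it is the trivial
  sigma-algebra. \<open>jump_filtration M W \<zeta> L k\<close> is the filtration \<open>\<G>\<close> with upper index \<open>k\<close>.
\<close>

definition jump_info ::
  "'a measure \<Rightarrow> (nat \<Rightarrow> 'a \<Rightarrow> ennreal) \<Rightarrow> (nat \<Rightarrow> 'a \<Rightarrow> real ^ 'd) \<Rightarrow> nat \<Rightarrow> real \<Rightarrow> 'a set set" where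
  "jump_info M \<zeta> L k t =
     sigma_sets (space M) (\<Union>i\<in>{1..k}.
       sigma_join (space M)
         (generated_sigma (space M)
            ((\<lambda>s \<omega>. indicator {\<omega>. \<zeta> i \<omega> \<le> ennreal s} \<omega> :: real) ` {0..t}))
         (generated_sigma (space M)
            ((\<lambda>s \<omega>. indicator {\<omega>. \<zeta> i \<omega> \<le> ennreal s} \<omega> *\<^sub>R L i \<omega>) ` {0..t})))"

definition jump_filtration ::
  "'a measure \<Rightarrow> (real \<Rightarrow> 'a \<Rightarrow> real ^ 'm) \<Rightarrow> (nat \<Rightarrow> 'a \<Rightarrow> ennreal) \<Rightarrow> (nat \<Rightarrow> 'a \<Rightarrow> real ^ 'd) \<Rightarrow>
     nat \<Rightarrow> real \<Rightarrow> 'a set set" where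
  "jump_filtration M W \<zeta> L k t =
     sigma_join (space M) (brownian_filtration M W t) (jump_info M \<zeta> L k t)"

text \<open>
  The library's \<^const>\<open>stopping_time\<close> forces a stopping time to take its values in the index type of
  the filtration; here the index is finite but the value may be \<open>\<infinity>\<close>.
\<close>

definition extended_stopping_time ::
  "'a measure \<Rightarrow> (real \<Rightarrow> 'a set set) \<Rightarrow> ('a \<Rightarrow> ennreal) \<Rightarrow> bool" where
  "extended_stopping_time M \<F> \<tau> \<longleftrightarrow> (\<forall>t\<ge>0. {\<omega> \<in> space M. \<tau> \<omega> \<le> ennreal t} \<in> \<F> t)"

text \<open>Jump times may be infinite, which encodes that there are at most \<open>n\<close> jumps.\<close>

locale jump_setting = prob_space M + complete_measure M
  for M :: "'a measure" +
  fixes W :: "real \<Rightarrow> 'a \<Rightarrow> real ^ 'm"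
    and n :: nat
    and E :: "(real ^ 'd) set"
    and \<zeta> :: "nat \<Rightarrow> 'a \<Rightarrow> ennreal"
    and L :: "nat \<Rightarrow> 'a \<Rightarrow> real ^ 'd"
  assumes brownian: "brownian_motion M W"
    and n_ge_1: "1 \<le> n"
    and E_borel: "E \<in> sets borel"
    and jump_measurable: "\<And>i. i \<in> {1..n} \<Longrightarrow> \<zeta> i \<in> borel_measurable M"
    and mark_measurable: "\<And>i. i \<in> {1..n} \<Longrightarrow> L i \<in> borel_measurable M"
    and mark_in_E: "\<And>i \<omega>. i \<in> {1..n} \<Longrightarrow> \<omega> \<in> space M \<Longrightarrow> L i \<omega> \<in> E"
    and jumps_ordered: "\<And>i \<omega>. i \<in> {1..<n} \<Longrightarrow> \<omega> \<in> space M \<Longrightarrow> \<zeta> i \<omega> \<le> \<zeta> (Suc i) \<omega>"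

text \<open>
  \<open>reaches_jump M \<zeta> \<tau>s k\<close> is the event that \<open>\<tau>s (j - 1) \<ge> \<zeta> j\<close> for all \<open>j = 1, \<dots>, k\<close>.
\<close>

definition reaches_jump ::
  "'a measure \<Rightarrow> (nat \<Rightarrow> 'a \<Rightarrow> ennreal) \<Rightarrow> (nat \<Rightarrow> 'a \<Rightarrow> ennreal) \<Rightarrow> nat \<Rightarrow> 'a set" where
  "reaches_jump M \<zeta> \<tau>s k = {\<omega> \<in> space M. \<forall>j\<in>{1..k}. \<tau>s (j - 1) \<omega> \<ge> \<zeta> j \<omega>}"

text \<open>
  \<open>decomposes_into M W n \<zeta> L \<tau> \<tau>s\<close> is the relation \<open>\<tau> \<sim> (\<tau>s 0, \<dots>, \<tau>s n)\<close>. That \<open>\<tau>s k\<close> depends on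
  the first \<open>k\<close> jump times and marks is expressed by its being a stopping time of
  \<open>jump_filtration M W \<zeta> L k\<close>. Products with indicators use \<open>0 * \<infinity> = 0\<close>.
\<close>

definition decomposes_into ::
  "'a measure \<Rightarrow> (real \<Rightarrow> 'a \<Rightarrow> real ^ 'm) \<Rightarrow> nat \<Rightarrow> (nat \<Rightarrow> 'a \<Rightarrow> ennreal) \<Rightarrow> (nat \<Rightarrow> 'a \<Rightarrow> real ^ 'd) \<Rightarrow>
     ('a \<Rightarrow> ennreal) \<Rightarrow> (nat \<Rightarrow> 'a \<Rightarrow> ennreal) \<Rightarrow> bool" where
  "decomposes_into M W n \<zeta> L \<tau> \<tau>s \<longleftrightarrow>
     extended_stopping_time M (brownian_filtration M W) (\<tau>s 0) \<and>
     (\<forall>k\<in>{1..n}. extended_stopping_time M (jump_filtration M W \<zeta> L k) (\<tau>s k) \<and>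
        (\<forall>\<omega>\<in>space M. \<tau>s k \<omega> \<ge> \<zeta> k \<omega>)) \<and>
     (\<forall>\<omega>\<in>space M.
        \<tau> \<omega> = \<tau>s 0 \<omega> * indicator {\<omega> \<in> space M. \<tau>s 0 \<omega> < \<zeta> 1 \<omega>} \<omega>
          + (\<Sum>k=1..n-1. \<tau>s k \<omega> *
               indicator (reaches_jump M \<zeta> \<tau>s k \<inter> {\<omega> \<in> space M. \<tau>s k \<omega> < \<zeta> (k + 1) \<omega>}) \<omega>)
          + \<tau>s n \<omega> * indicator (reaches_jump M \<zeta> \<tau>s n) \<omega>)"

text \<open>Consistency checks for the definitions above.\<close>

lemma sigma_algebra_brownian_filtration:
  fixes M :: "'a measure"
  shows "sigma_algebra (space M) (brownian_filtration M W t)"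
proof -
  define \<G> where "\<G> = (\<lambda>s. generated_sigma (space M) (W ` {0..s}) \<union> null_sets M)"
  have "generated_sigma (space M) (W ` {0..s}) \<subseteq> Pow (space M)" for s
    unfolding generated_sigma_def by (rule sigma_algebra.sigma_sets_subset[OF sigma_algebra_Pow]) auto
  then have G: "\<G> s \<subseteq> Pow (space M)" for s
    unfolding \<G>_def using sets.space_closed[of M] by (auto simp: null_sets_def)
  then have S: "sigma_algebra (space M) (sigma_sets (space M) (\<G> s))" for s
    by (rule sigma_algebra_sigma_sets)
  have B: "brownian_filtration M W t = (\<Inter>s\<in>{t<..}. sigma_sets (space M) (\<G> s))"
    by (simp add: brownian_filtration_def sigma_join_def \<G>_def)
  have "brownian_filtration M W t \<subseteq> Pow (space M)"
    unfolding B using sigma_sets_into_sp[OF G] gt_ex[of t] by blast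
  moreover have "\<Union>(range A) \<in> (\<Inter>s\<in>{t<..}. sigma_sets (space M) (\<G> s))"
    if "range A \<subseteq> (\<Inter>s\<in>{t<..}. sigma_sets (space M) (\<G> s))" for A :: "nat \<Rightarrow> 'a set"
  proof
    fix s assume "s \<in> {t<..}"
    with that have "A i \<in> sigma_sets (space M) (\<G> s)" for i by blast
    then show "\<Union>(range A) \<in> sigma_sets (space M) (\<G> s)" by (rule sigma_sets.Union)
  qed
  ultimately show ?thesis
    unfolding sigma_algebra_iff2 B
    by (auto intro: sigma_sets.Empty sigma_sets.Compl)
qed

lemma (in jump_setting) usual_conditions_brownian_filtration:
  "usual_conditions M (brownian_filtration M W)"
proof -
  have W: "W t \<in> borel_measurable M" if "0 \<le> t" for t
    using brownian that by (auto simp: brownian_motion_def)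
  let ?H = "\<lambda>s. sigma_join (space M) (generated_sigma (space M) (W ` {0..s})) (null_sets M)"
  have sub: "?H s \<subseteq> sets M" for s
    unfolding sigma_join_def generated_sigma_def
    by (intro sets.sigma_sets_subset Un_least) (auto intro: measurable_sets[OF W])
  have mono: "?H s \<subseteq> ?H t" if "s \<le> t" for s t
    unfolding sigma_join_def generated_sigma_def
    by (intro sigma_sets_mono' Un_mono subset_refl) (use that in fastforce)
  have null: "null_sets M \<subseteq> ?H s" for s
    unfolding sigma_join_def by auto
  have B: "brownian_filtration M W t = (\<Inter>s\<in>{t<..}. ?H s)" for t
    by (simp add: brownian_filtration_def)
  have sets: "brownian_filtration M W t \<subseteq> sets M" for t
    using sub[of "t + 1"] unfolding B by force
  have incr: "brownian_filtration M W s \<subseteq> brownian_filtration M W t" if "s \<le> t" for s t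
    unfolding B using that by force
  have null0: "null_sets M \<subseteq> brownian_filtration M W 0"
    unfolding B using null by blast
  have rc: "brownian_filtration M W t = (\<Inter>s\<in>{t<..}. brownian_filtration M W s)" for t
  proof
    show "(\<Inter>s\<in>{t<..}. brownian_filtration M W s) \<subseteq> brownian_filtration M W t"
    proof
      fix A assume A: "A \<in> (\<Inter>s\<in>{t<..}. brownian_filtration M W s)"
      show "A \<in> brownian_filtration M W t"
        unfolding B
      proof
        fix s assume "s \<in> {t<..}"
        then obtain r where "t < r" "r < s" using dense by auto
        with A show "A \<in> ?H s" unfolding B by auto
      qed
    qed
  qed (use B in force)
  show ?thesis
    unfolding usual_conditions_def
    by (intro conjI allI impI complete_measure_axioms sigma_algebra_brownian_filtration
          sets incr null0 rc) auto
qed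

lemma (in jump_setting) jump_filtration_0:
  "jump_filtration M W \<zeta> L 0 t = brownian_filtration M W t"
proof -
  interpret F: sigma_algebra "space M" "brownian_filtration M W t"
    by (rule sigma_algebra_brownian_filtration)
  have "jump_info M \<zeta> L 0 t \<subseteq> brownian_filtration M W t"
    unfolding jump_info_def by (rule F.sigma_sets_subset) simp
  then show ?thesis
    by (simp add: jump_filtration_def sigma_join_def Un_absorb2 F.sigma_sets_eq)
qed

end

theory Submission
  imports Defs
begin

text \<open>
  The claim is pointwise. Fix an outcome and let \<open>k\<close> be the first index at which \<open>\<tau>s k\<close> stops before
  the jump \<open>k + 1\<close>, or \<open>n\<close> if there is none. Then \<open>\<tau>\<close> equals \<open>\<tau>s k\<close> and hence lies in the \<open>k\<close>-th inter-jump interval. Both the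
  events in terms of the \<open>\<tau>s\<close> and the inter-jump intervals are pairwise disjoint, so for each of the two
  families \<open>k\<close> is the only index whose event occurs.
\<close>

text \<open>\<open>n\<close> satisfies the guarded exit condition vacuously, so a least such index
  exists and is at most \<open>n\<close>. Every smaller index fails the condition, and each failure
  is one of the required lower bounds on \<open>t\<close>.\<close>

lemma ex_exit_index:
  fixes z t :: "nat \<Rightarrow> 'b::linorder"
  obtains k where "k \<le> n" "\<forall>j\<in>{1..k}. z j \<le> t (j - 1)" "k < n \<longrightarrow> t k < z (k + 1)"
proof -
  let ?P = "\<lambda>k. k < n \<longrightarrow> t k < z (k + 1)"
  define k where "k = (LEAST k. ?P k)"
  have "?P n" by simp
  then have "k \<le> n" "?P k"
    unfolding k_def by (rule Least_le, rule LeastI)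
  \<comment> \<open>The index \<open>j - 1\<close> lies below the least one;
    \<open>j \<ge> 1\<close> makes the truncated subtraction genuine.\<close>
  moreover have "z j \<le> t (j - 1)" if "j \<in> {1..k}" for j
    using not_less_Least[of "j - 1" ?P] that unfolding k_def[symmetric]
    by (cases j) auto
  ultimately show thesis using that by blast
qed

text \<open>Two distinct indices clash at the smaller one, \<open>i\<close> say: it is below
  \<open>n\<close>, so it demands \<open>t i < z (i + 1)\<close>, whereas the larger one demands
  \<open>z (i + 1) \<le> t i\<close>.\<close>

lemma exit_index_unique:
  fixes z t :: "nat \<Rightarrow> 'b::linorder"
  assumes "k \<le> n" "\<forall>j\<in>{1..k}. z j \<le> t (j - 1)" "k < n \<longrightarrow> t k < z (k + 1)"
    and "m \<le> n"
  shows "(\<forall>j\<in>{1..m}. z j \<le> t (j - 1)) \<and> (m < n \<longrightarrow> t m < z (m + 1)) \<longleftrightarrow> m = k"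
proof (cases m k rule: linorder_cases)
  case less
  then have "z (m + 1) \<le> t m" using assms(2)[rule_format, of "m + 1"] by simp
  then show ?thesis using less assms by auto
next
  case greater
  then have "\<not> z (k + 1) \<le> t k" using assms by auto
  then show ?thesis using greater by (auto dest!: bspec[of _ _ "k + 1"])
qed (use assms in auto)

text \<open>The guards drop the lower bound at index \<open>0\<close> and the upper bound at
  \<open>n\<close>. Monotonicity carries a bound on \<open>x\<close> from \<open>k\<close> to any
  other index: \<open>z (m + 1) \<le> z k \<le> x\<close> if \<open>m < k\<close>, and
  \<open>x < z (k + 1) \<le> z m\<close> if \<open>m > k\<close>.\<close>

lemma interval_index_unique:
  fixes z :: "nat \<Rightarrow> 'b::linorder"
  assumes z: "\<And>i. i \<in> {1..<n} \<Longrightarrow> z i \<le> z (Suc i)"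
    and k: "k \<le> n" "k \<noteq> 0 \<longrightarrow> z k \<le> x" "k < n \<longrightarrow> x < z (k + 1)"
    and "m \<le> n"
  shows "(m \<noteq> 0 \<longrightarrow> z m \<le> x) \<and> (m < n \<longrightarrow> x < z (m + 1)) \<longleftrightarrow> m = k"
proof -
  \<comment> \<open>\<open>z 0\<close> is not a jump time and is unconstrained, hence
    \<open>1 \<le> i\<close>.\<close>
  have mono: "z i \<le> z j" if "i \<le> j" "1 \<le> i" "j \<le> n" for i j
    using that(1,3) by (induction rule: dec_induct) (use that(2) z in \<open>force intro: order_trans\<close>)+
  show ?thesis
  proof (cases m k rule: linorder_cases)
    case less
    then have "z (m + 1) \<le> x" using mono[of "m + 1" k] k by force
    then show ?thesis using less k by auto
  next
    case greater
    then have "x < z m" using mono[of "k + 1" m] k \<open>m \<le> n\<close> by force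
    then show ?thesis using greater by auto
  qed (use k in auto)
qed

theorem proposition2p3:
  fixes M :: "'a measure"
    and W :: "real \<Rightarrow> 'a \<Rightarrow> real ^ 'm"
    and n :: nat
    and E :: "(real ^ 'd) set"
    and \<zeta> :: "nat \<Rightarrow> 'a \<Rightarrow> ennreal"
    and L :: "nat \<Rightarrow> 'a \<Rightarrow> real ^ 'd"
    and \<tau> :: "'a \<Rightarrow> ennreal"
    and \<tau>s :: "nat \<Rightarrow> 'a \<Rightarrow> ennreal"
  assumes setting: "jump_setting M W n E \<zeta> L"
    and stopping: "extended_stopping_time M (jump_filtration M W \<zeta> L n) \<tau>"
    and decomposition: "decomposes_into M W n \<zeta> L \<tau> \<tau>s"
  shows "{\<omega> \<in> space M. \<tau>s 0 \<omega> < \<zeta> 1 \<omega>} = {\<omega> \<in> space M. \<tau> \<omega> < \<zeta> 1 \<omega>} \<and>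
         (\<forall>k\<in>{1..n-1}.
           reaches_jump M \<zeta> \<tau>s k \<inter> {\<omega> \<in> space M. \<tau>s k \<omega> < \<zeta> (k + 1) \<omega>} =
           {\<omega> \<in> space M. \<zeta> k \<omega> \<le> \<tau> \<omega> \<and> \<tau> \<omega> < \<zeta> (k + 1) \<omega>}) \<and>
         reaches_jump M \<zeta> \<tau>s n = {\<omega> \<in> space M. \<zeta> n \<omega> \<le> \<tau> \<omega>} \<and>
         (\<forall>\<omega>\<in>space M.
           \<tau> \<omega> = \<tau>s 0 \<omega> * indicator {\<omega> \<in> space M. \<tau> \<omega> < \<zeta> 1 \<omega>} \<omega>
             + (\<Sum>k=1..n-1. \<tau>s k \<omega> *
                  indicator {\<omega> \<in> space M. \<zeta> k \<omega> \<le> \<tau> \<omega> \<and> \<tau> \<omega> < \<zeta> (k + 1) \<omega>} \<omega>)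
             + \<tau>s n \<omega> * indicator {\<omega> \<in> space M. \<zeta> n \<omega> \<le> \<tau> \<omega>} \<omega>)"
proof -
  interpret jump_setting M W n E \<zeta> L by (rule setting)
  \<comment> \<open>The guards merge the first, middle and last cases into one family over
    \<open>0..n\<close>. As \<open>n \<ge> 1\<close>, the upper bound is active at \<open>0\<close>
    and the lower one at \<open>n\<close>.\<close>
  let ?A = "\<lambda>k. reaches_jump M \<zeta> \<tau>s k \<inter> {\<omega> \<in> space M. k < n \<longrightarrow> \<tau>s k \<omega> < \<zeta> (k + 1) \<omega>}"
  let ?B = "\<lambda>k. {\<omega> \<in> space M. (k \<noteq> 0 \<longrightarrow> \<zeta> k \<omega> \<le> \<tau> \<omega>) \<and> (k < n \<longrightarrow> \<tau> \<omega> < \<zeta> (k + 1) \<omega>)}"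
  have A0: "{\<omega> \<in> space M. \<tau>s 0 \<omega> < \<zeta> 1 \<omega>} = ?A 0"
    and An: "reaches_jump M \<zeta> \<tau>s n = ?A n"
    using n_ge_1 by (auto simp: reaches_jump_def)
  have Ak: "reaches_jump M \<zeta> \<tau>s k \<inter> {\<omega> \<in> space M. \<tau>s k \<omega> < \<zeta> (k + 1) \<omega>} = ?A k"
    if "k \<in> {1..n-1}" for k
    using that by auto
  have B0: "{\<omega> \<in> space M. \<tau> \<omega> < \<zeta> 1 \<omega>} = ?B 0"
    and Bn: "{\<omega> \<in> space M. \<zeta> n \<omega> \<le> \<tau> \<omega>} = ?B n"
    using n_ge_1 by auto
  have Bk: "{\<omega> \<in> space M. \<zeta> k \<omega> \<le> \<tau> \<omega> \<and> \<tau> \<omega> < \<zeta> (k + 1) \<omega>} = ?B k"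
    if "k \<in> {1..n-1}" for k
    using that by auto
  have sumA: "(\<Sum>k=1..n-1. \<tau>s k \<omega> *
        indicator (reaches_jump M \<zeta> \<tau>s k \<inter> {\<omega> \<in> space M. \<tau>s k \<omega> < \<zeta> (k + 1) \<omega>}) \<omega>) =
      (\<Sum>k=1..n-1. \<tau>s k \<omega> * indicator (?A k) \<omega>)" for \<omega>
    by (rule sum.cong[OF refl], subst Ak) auto
  have \<tau>: "\<tau> \<omega> = \<tau>s 0 \<omega> * indicator (?A 0) \<omega> + (\<Sum>k=1..n-1. \<tau>s k \<omega> * indicator (?A k) \<omega>)
      + \<tau>s n \<omega> * indicator (?A n) \<omega>" if "\<omega> \<in> space M" for \<omega>
    using decomposition that unfolding decomposes_into_def A0[symmetric] An[symmetric] sumA[symmetric]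
    by blast
  have pointwise: "\<omega> \<in> ?A m \<longleftrightarrow> \<omega> \<in> ?B m" if \<omega>: "\<omega> \<in> space M" and m: "m \<le> n" for m \<omega>
  proof -
    obtain k where k: "k \<le> n" "\<forall>j\<in>{1..k}. \<zeta> j \<omega> \<le> \<tau>s (j - 1) \<omega>"
        "k < n \<longrightarrow> \<tau>s k \<omega> < \<zeta> (k + 1) \<omega>"
      by (rule ex_exit_index[of n "\<lambda>j. \<zeta> j \<omega>" "\<lambda>j. \<tau>s j \<omega>"])
    have A: "\<omega> \<in> ?A i \<longleftrightarrow> i = k" if "i \<le> n" for i
      using exit_index_unique[of k n "\<lambda>j. \<zeta> j \<omega>" "\<lambda>j. \<tau>s j \<omega>" i, OF k that] \<omega>
      unfolding reaches_jump_def by simp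
    have ind: "indicator (?A i) \<omega> = (if i = k then 1 else 0 :: ennreal)" if "i \<le> n" for i
      using A[OF that] unfolding indicator_def by simp
    have sum: "(\<Sum>i=1..n-1. \<tau>s i \<omega> * indicator (?A i) \<omega>)
        = (\<Sum>i=1..n-1. if i = k then \<tau>s i \<omega> else 0)"
      by (intro sum.cong refl) (use ind in auto)
    \<comment> \<open>Since \<open>n \<ge> 1\<close>, the indices \<open>0\<close>,
      \<open>{1..n-1}\<close> and \<open>n\<close> are disjoint and cover \<open>k\<close>, so
      exactly one term survives. The others vanish even at infinite values, because
      \<open>\<infinity> * 0 = 0\<close>.\<close>
    have "\<tau> \<omega> = \<tau>s k \<omega>"
      unfolding \<tau>[OF \<omega>] sum ind[OF le0] ind[OF order_refl]
      using k(1) n_ge_1 by (auto simp: sum.delta)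
    \<comment> \<open>The reach conditions only bound \<open>\<tau>s (k - 1)\<close> below by
      \<open>\<zeta> k\<close>; for \<open>\<tau>s k\<close> itself the bound is part of the
      decomposition.\<close>
    moreover have "\<zeta> k \<omega> \<le> \<tau>s k \<omega>" if "k \<noteq> 0"
      using decomposition \<omega> that k(1) unfolding decomposes_into_def by auto
    ultimately have "k \<noteq> 0 \<longrightarrow> \<zeta> k \<omega> \<le> \<tau> \<omega>" "k < n \<longrightarrow> \<tau> \<omega> < \<zeta> (k + 1) \<omega>"
      using k(3) by auto
    \<comment> \<open>The exit index \<open>k\<close> is thus also the interval index of
      \<open>\<tau> \<omega>\<close>, so both memberships reduce to \<open>m = k\<close>.\<close>
    from interval_index_unique[of n "\<lambda>j. \<zeta> j \<omega>", OF jumps_ordered[OF _ \<omega>] k(1) this m]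
    have "\<omega> \<in> ?B m \<longleftrightarrow> m = k" using \<omega> by simp
    with A[OF m] show ?thesis by simp
  qed
  \<comment> \<open>Outcomes outside \<open>space M\<close> belong to neither set.\<close>
  have AB: "?A m = ?B m" if "m \<le> n" for m
  proof (rule set_eqI)
    fix \<omega>
    show "\<omega> \<in> ?A m \<longleftrightarrow> \<omega> \<in> ?B m"
      using pointwise[of \<omega> m] that by (cases "\<omega> \<in> space M") auto
  qed
  have sumB: "(\<Sum>k=1..n-1. \<tau>s k \<omega> * indicator (?A k) \<omega>) = (\<Sum>k=1..n-1. \<tau>s k \<omega> *
      indicator {\<omega> \<in> space M. \<zeta> k \<omega> \<le> \<tau> \<omega> \<and> \<tau> \<omega> < \<zeta> (k + 1) \<omega>} \<omega>)" for \<omega>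
    by (rule sum.cong[OF refl], subst Bk, assumption, subst AB) auto
  show ?thesis
  proof (intro conjI ballI)
    show "{\<omega> \<in> space M. \<tau>s 0 \<omega> < \<zeta> 1 \<omega>} = {\<omega> \<in> space M. \<tau> \<omega> < \<zeta> 1 \<omega>}"
      unfolding A0 B0 by (rule AB) simp
    show "reaches_jump M \<zeta> \<tau>s k \<inter> {\<omega> \<in> space M. \<tau>s k \<omega> < \<zeta> (k + 1) \<omega>} =
        {\<omega> \<in> space M. \<zeta> k \<omega> \<le> \<tau> \<omega> \<and> \<tau> \<omega> < \<zeta> (k + 1) \<omega>}" if "k \<in> {1..n-1}" for k
      unfolding Ak[OF that] Bk[OF that] by (rule AB) (use that in auto)
    show "reaches_jump M \<zeta> \<tau>s n = {\<omega> \<in> space M. \<zeta> n \<omega> \<le> \<tau> \<omega>}"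
      by (subst An, subst Bn) (rule AB, simp)
    \<comment> \<open>This is the given decomposition of \<open>\<tau>\<close> with each event
      replaced by its interval.\<close>
    show "\<tau> \<omega> = \<tau>s 0 \<omega> * indicator {\<omega> \<in> space M. \<tau> \<omega> < \<zeta> 1 \<omega>} \<omega>
        + (\<Sum>k=1..n-1. \<tau>s k \<omega> *
             indicator {\<omega> \<in> space M. \<zeta> k \<omega> \<le> \<tau> \<omega> \<and> \<tau> \<omega> < \<zeta> (k + 1) \<omega>} \<omega>)
        + \<tau>s n \<omega> * indicator {\<omega> \<in> space M. \<zeta> n \<omega> \<le> \<tau> \<omega>} \<omega>" if "\<omega> \<in> space M" for \<omega>
      using \<tau>[OF that] unfolding sumB AB[OF le0] AB[OF order_refl] B0[symmetric] Bn[symmetric] .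
  qed
qed

end
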